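(* Let $p,q\ge 0$ be integers and let $a_1,\dots,a_p,b_1,\dots,b_q$ be arbitrary constants. For every integer $N\ge 0$ put $$F_N(x)={}_{p+N+1}F_{q+N+1}\Bigl(a_1,\dots,a_p,\tfrac{\alpha+1}{\gamma},\tfrac{\alpha+\beta+1}{\gamma},\dots,\tfrac{\alpha+N\beta+1}{\gamma};\,b_1,\dots,b_q,\tfrac{\alpha+\gamma+1}{\gamma},\tfrac{\alpha+\gamma+\beta+1}{\gamma},\dots,\tfrac{\alpha+\gamma+N\beta+1}{\gamma};\,\lambda x^{\gamma}\Bigr).$$ Then, for any constants $\alpha,\beta,\eta,\lambda$ and any nonzero constant $\gamma$, $$\int x^\alpha \cos(\eta x^\beta)\,{}_pF_q(a_1,\dots,a_p;b_1,\dots,b_q;\lambda x^{\gamma})\,dx = x^{\alpha+1}\cos(\eta x^\beta)\sum_{j=0}^{\infty}\frac{(-1)^j(\beta\eta x^\beta)^{2j}}{\prod_{m=0}^{2j}(\alpha+m\beta+1)}\,F_{2j}(x)+x^{\alpha+1}\sin(\eta x^\beta)\sum_{j=0}^{\infty}\frac{(-1)^j(\beta\eta x^\beta)^{2j+1}}{\prod_{m=0}^{2j+1}(\alpha+m\beta+1)}\,F_{2j+1}(x)+C,$$ where $C$ is an arbitrary constant of integration.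
   Context: Constants are real or complex. The generalized hypergeometric function is defined by the series $${}_pF_q(a_1,\dots,a_p;b_1,\dots,b_q;x)=\sum_{n=0}^{\infty}\frac{(a_1)_n\cdots(a_p)_n}{(b_1)_n\cdots(b_q)_n}\frac{x^n}{n!},$$ with Pochhammer symbol $(\vartheta)_n=\Gamma(\vartheta+n)/\Gamma(\vartheta)$, $(\vartheta)_0=1$. The integral is an indefinite integral (antiderivative) in $x$.
   Formalization: Assumes no α+mβ+1 is 0, no added lower parameter of F_N is in {0,−1,…}, and, if β/γ is a negative irrational (where they can diverge), that the two outer series converge; powers are principal, with x in a domain off (−∞,0] on which the given pFq converges. *)

theory Defs
  imports "HOL-Analysis.Analysis"
begin

definition hypergeo_term :: "complex list \<Rightarrow> complex list \<Rightarrow> complex \<Rightarrow> nat \<Rightarrow> complex" where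
  "hypergeo_term a b z n =
     (\<Prod>u\<leftarrow>a. pochhammer u n) / (\<Prod>v\<leftarrow>b. pochhammer v n) * (z ^ n / fact n)"

text \<open>
  The generalized hypergeometric series, with \<open>p = length a\<close> and \<open>q = length b\<close>.
  The value is meaningful only where the series is summable.  If some \<open>v\<close> in \<open>b\<close> is a
  nonpositive integer, the terms with a vanishing denominator are \<open>0\<close> by \<open>x / 0 = 0\<close>.
\<close>
definition hypergeo :: "complex list \<Rightarrow> complex list \<Rightarrow> complex \<Rightarrow> complex" where
  "hypergeo a b z = (\<Sum>n. hypergeo_term a b z n)"

lemma hypergeo_conv_eval_fps: "hypergeo a b z = eval_fps (fps_hypergeo a b 1) z"
proof -
  have "foldl (\<lambda>r u. r * pochhammer u n) c xs = c * (\<Prod>u\<leftarrow>xs. pochhammer u n)"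
    for n and c :: complex and xs
    by (induction xs arbitrary: c) (simp_all add: mult.assoc)
  then show ?thesis
    by (simp add: hypergeo_def hypergeo_term_def eval_fps_def fps_hypergeo_nth)
qed

text \<open>
  The parameters \<open>(\<alpha> + m\<beta> + 1)/\<gamma>\<close> for \<open>m = 0, \<dots>, N\<close>; the additional lower parameters of
  \<open>F\<^sub>N\<close> are obtained with \<open>\<alpha> + \<gamma>\<close> in place of \<open>\<alpha>\<close>.
\<close>
definition extra_params :: "complex \<Rightarrow> complex \<Rightarrow> complex \<Rightarrow> nat \<Rightarrow> complex list" where
  "extra_params \<alpha> \<beta> \<gamma> N = map (\<lambda>m. (\<alpha> + of_nat m * \<beta> + 1) / \<gamma>) [0..<Suc N]"

text \<open>All powers with complex exponent are principal values, \<open>x powr s = exp (s * Ln x)\<close>.\<close>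
definition F_fun :: "complex list \<Rightarrow> complex list \<Rightarrow> complex \<Rightarrow> complex \<Rightarrow> complex \<Rightarrow> complex
    \<Rightarrow> nat \<Rightarrow> complex \<Rightarrow> complex" where
  "F_fun a b \<alpha> \<beta> \<gamma> \<mu> N x =
     hypergeo (a @ extra_params \<alpha> \<beta> \<gamma> N) (b @ extra_params (\<alpha> + \<gamma>) \<beta> \<gamma> N) (\<mu> * x powr \<gamma>)"

text \<open>The terms of the cosine series have \<open>N = 2 * j\<close>, those of the sine series \<open>N = 2 * j + 1\<close>.\<close>
definition trig_term :: "complex list \<Rightarrow> complex list \<Rightarrow> complex \<Rightarrow> complex \<Rightarrow> complex \<Rightarrow> complex
    \<Rightarrow> complex \<Rightarrow> complex \<Rightarrow> nat \<Rightarrow> complex" where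
  "trig_term a b \<alpha> \<beta> \<gamma> \<eta> \<mu> x N =
     (\<beta> * \<eta> * x powr \<beta>) ^ N / (\<Prod>m=0..N. \<alpha> + of_nat m * \<beta> + 1) * F_fun a b \<alpha> \<beta> \<gamma> \<mu> N x"

end

theory Submission
  imports Defs "HOL-Probability.Characteristic_Functions"
begin

text \<open>
  Put \<open>u = \<eta> x\<^sup>\<beta>\<close>, and let \<open>g N x\<close> be \<open>x\<^sup>\<alpha>\<^sup>+\<^sup>1\<close> times the term of index \<open>N\<close> of the two outer series,
  without sign.  The series for \<open>F\<^sub>N\<close> has lower parameters that exceed its additional upper
  parameters by \<open>1\<close>, so up to a constant its coefficients are those of the given hypergeometric
  function divided by \<open>\<Prod>m\<le>N. (\<alpha> + m\<beta> + 1 + n\<gamma>)\<close>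
  (\<open>hypergeo_term_extra_params\<close>).  These divisors are exactly what termwise integration produces, and
  therefore \<open>g 0\<close> is an antiderivative of \<open>x\<^sup>\<alpha> F\<close>, where \<open>F\<close> is the given hypergeometric function, and
  \<open>g (N+1)\<close> is an antiderivative of \<open>u' * g N\<close> (\<open>trig_tower_has_derivative\<close>).  The formula is the
  result of integrating \<open>cos u * x\<^sup>\<alpha> F\<close> by parts infinitely often.

  To justify the limit, the partial sums are differentiated.  Their derivative differs from the
  integrand by \<open>cos u * u' * g (2J+1)\<close> up to sign, which has to tend to \<open>0\<close> locally uniformly.  Here
  only pointwise convergence of the outer series is needed: since \<open>g (N+1)\<close> is an antiderivative of
  \<open>u' * g N\<close>, on a small ball its supremum is at most its modulus at the centre plus half the supremum
  of \<open>g N\<close>, and the centre values tend to \<open>0\<close>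
  (\<open>antiderivative_tower_uniform_null\<close>, \<open>repeated_integration_by_parts\<close>).

  Pointwise convergence is a hypothesis when \<open>\<beta> / \<gamma>\<close> is a negative irrational number.  Otherwise,
  for \<open>\<beta> \<noteq> 0\<close>, the divisors \<open>\<alpha> + m\<beta> + 1 + n\<gamma>\<close> stay away from \<open>0\<close> (\<open>exponent_bounded_away\<close>), and for each
  \<open>K\<close> the number of \<open>m\<close> for which the divisor has modulus less than \<open>K\<close> is bounded independently of \<open>n\<close>.
  Hence the products grow faster than every geometric sequence, uniformly in \<open>n\<close>
  (\<open>prod_exponent_lower_bound\<close>), and the terms of the outer series decay geometrically.
\<close>

section \<open>Series of iterated antiderivatives\<close>

lemma halving_recursion_null:
  fixes a e :: "nat \<Rightarrow> real"
  assumes e: "e \<longlonglongrightarrow> 0" and a: "\<And>n. a (Suc n) = e n + a n / 2"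
  shows "a \<longlonglongrightarrow> 0"
proof (rule LIMSEQ_I)
  fix r :: real
  assume "0 < r"
  then have "0 < r / 4" by simp
  from LIMSEQ_D[OF e this] obtain n0 where n0: "\<And>n. n \<ge> n0 \<Longrightarrow> \<bar>e n\<bar> < r / 4"
    by auto
  have bound: "\<bar>a (n0 + k)\<bar> \<le> r / 2 + \<bar>a n0\<bar> * (1 / 2) ^ k" for k
  proof (induction k)
    case 0
    show ?case using \<open>0 < r\<close> by simp
  next
    case (Suc k)
    have "\<bar>a (n0 + Suc k)\<bar> \<le> \<bar>e (n0 + k)\<bar> + \<bar>a (n0 + k)\<bar> / 2"
      by (simp add: a)
    also have "\<dots> \<le> r / 4 + (r / 2 + \<bar>a n0\<bar> * (1 / 2) ^ k) / 2"
      using n0[of "n0 + k"] Suc by (intro add_mono divide_right_mono) auto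
    finally show ?case by (simp add: field_simps)
  qed
  have "(\<lambda>k. \<bar>a n0\<bar> * (1 / 2) ^ k) \<longlonglongrightarrow> 0"
    by (intro tendsto_mult_right_zero LIMSEQ_power_zero) simp
  from LIMSEQ_D[OF this, of "r / 2"] \<open>0 < r\<close>
  obtain k0 where k0: "\<And>k. k \<ge> k0 \<Longrightarrow> \<bar>a n0\<bar> * (1 / 2) ^ k < r / 2"
    by (auto simp: abs_mult)
  show "\<exists>n1. \<forall>n\<ge>n1. norm (a n - 0) < r"
  proof (intro exI allI impI)
    fix n assume n: "n \<ge> n0 + k0"
    then have "k0 \<le> n - n0" by simp
    from n have "\<bar>a n\<bar> \<le> r / 2 + \<bar>a n0\<bar> * (1 / 2) ^ (n - n0)"
      using bound[of "n - n0"] by simp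
    with k0[OF \<open>k0 \<le> n - n0\<close>] show "norm (a n - 0) < r" by simp
  qed
qed

text \<open>
  Convergence to \<open>0\<close> at a single point spreads to a neighbourhood.  On a ball so small that
  the radius times a bound of \<open>\<bar>h\<bar>\<close> is at most \<open>1/2\<close>, the mean value inequality gives
  \<open>sup \<bar>g (N+1)\<bar> \<le> \<bar>g (N+1) x0\<bar> + sup \<bar>g N\<bar> / 2\<close>, a recursion whose solutions tend to \<open>0\<close>.
  This is what turns merely pointwise convergence of the outer series into enough uniformity to
  differentiate them.
\<close>
lemma antiderivative_tower_uniform_null:
  fixes g :: "nat \<Rightarrow> complex \<Rightarrow> complex" and h :: "complex \<Rightarrow> complex"
  assumes "open S" "x0 \<in> S"
    and g: "\<And>N x. x \<in> S \<Longrightarrow> (g (Suc N) has_field_derivative h x * g N x) (at x)"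
    and h: "continuous_on S h" and g0: "continuous_on S (g 0)"
    and null: "(\<lambda>N. g N x0) \<longlonglongrightarrow> 0"
  obtains r where "r > 0" "cball x0 r \<subseteq> S" "uniform_limit (cball x0 r) g (\<lambda>_. 0) sequentially"
proof -
  obtain r0 where r0: "r0 > 0" "cball x0 r0 \<subseteq> S"
    using assms(1,2) open_contains_cball by blast
  have "bounded (h ` cball x0 r0)" "bounded (g 0 ` cball x0 r0)"
    using r0 h g0 by (auto intro!: compact_imp_bounded compact_continuous_image
        intro: continuous_on_subset)
  then obtain M A where M: "M > 0" "\<And>x. x \<in> cball x0 r0 \<Longrightarrow> norm (h x) \<le> M"
    and A: "\<And>x. x \<in> cball x0 r0 \<Longrightarrow> norm (g 0 x) \<le> A"
    unfolding bounded_pos by fastforce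
  \<comment> \<open>The radius makes \<open>M * r \<le> 1/2\<close>, the contraction factor of the recursion.\<close>
  define r where "r = min r0 (1 / (2 * M))"
  have r: "r > 0" "r \<le> r0" "M * r \<le> 1 / 2"
    using r0 M by (auto simp: r_def min_def field_simps)
  have sub: "x \<in> cball x0 r0" "x \<in> S" if "x \<in> cball x0 r" for x
    using that r r0 by auto
  define a where "a = rec_nat A (\<lambda>n y. norm (g (Suc n) x0) + y / 2)"
  have a_Suc: "a (Suc n) = norm (g (Suc n) x0) + a n / 2" for n
    by (simp add: a_def)
  have bound: "norm (g N x) \<le> a N" if "x \<in> cball x0 r" for N x
    using that
  proof (induction N arbitrary: x)
    case 0
    then show ?case using A sub by (simp add: a_def)
  next
    case (Suc N)
    have a_nonneg: "0 \<le> a N"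
      using Suc.IH[OF Suc.prems] norm_ge_zero order_trans by blast
    have "norm (h y * g N y) \<le> M * a N" if "y \<in> cball x0 r" for y
      using M Suc.IH[OF that] sub[OF that] by (auto simp: norm_mult intro!: mult_mono)
    then have "norm (g (Suc N) x - g (Suc N) x0) \<le> M * a N * norm (x - x0)"
      using Suc.prems r(1)
      by (intro field_differentiable_bound[of "cball x0 r" "g (Suc N)" "\<lambda>y. h y * g N y"])
        (auto intro!: has_field_derivative_at_within g sub(2))
    also have "\<dots> \<le> M * a N * r"
      using M(1) a_nonneg Suc.prems
      by (intro mult_left_mono) (auto simp: dist_norm norm_minus_commute)
    also have "\<dots> \<le> a N / 2"
      using mult_right_mono[OF r(3) a_nonneg]
      by (simp add: mult.assoc mult.commute mult.left_commute)
    finally show ?case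
      using norm_triangle_sub[of "g (Suc N) x" "g (Suc N) x0"] by (simp add: a_Suc)
  qed
  have "a \<longlonglongrightarrow> 0"
    using LIMSEQ_Suc[OF tendsto_norm_zero[OF null]] a_Suc by (rule halving_recursion_null)
  then have "uniform_limit (cball x0 r) g (\<lambda>_. 0) sequentially"
    unfolding uniform_limit_iff
  proof (intro allI impI)
    fix e :: real
    assume "0 < e"
    with \<open>a \<longlonglongrightarrow> 0\<close> have "\<forall>\<^sub>F N in sequentially. a N < e"
      by (rule order_tendstoD(2))
    then show "\<forall>\<^sub>F N in sequentially. \<forall>x\<in>cball x0 r. dist (g N x) 0 < e"
      by eventually_elim (simp add: le_less_trans[OF bound])
  qed
  moreover have "cball x0 r \<subseteq> S" using sub by auto
  ultimately show ?thesis using that r by blast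
qed

text \<open>
  Integrating \<open>cos u * f\<close> by parts over and over, each time integrating the factor \<open>g N\<close> and
  differentiating the trigonometric one, gives these two series.  Differentiating their partial
  sums, everything telescopes except the integrand and one remainder, which contains the last odd
  antiderivative.  It tends to \<open>0\<close> locally uniformly because pointwise summability forces
  \<open>g N x0 \<longlonglongrightarrow> 0\<close>, so the limit may be differentiated.
\<close>
lemma repeated_integration_by_parts:
  fixes g :: "nat \<Rightarrow> complex \<Rightarrow> complex" and f h u :: "complex \<Rightarrow> complex"
  assumes S: "open S" "x0 \<in> S"
    and g0: "\<And>x. x \<in> S \<Longrightarrow> (g 0 has_field_derivative f x) (at x)"
    and g_Suc: "\<And>N x. x \<in> S \<Longrightarrow> (g (Suc N) has_field_derivative h x * g N x) (at x)"
    and u: "\<And>x. x \<in> S \<Longrightarrow> (u has_field_derivative h x) (at x)"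
    and h: "continuous_on S h"
    and even: "\<And>x. x \<in> S \<Longrightarrow> summable (\<lambda>j. (-1) ^ j * g (2 * j) x)"
    and odd: "\<And>x. x \<in> S \<Longrightarrow> summable (\<lambda>j. (-1) ^ j * g (2 * j + 1) x)"
  shows "((\<lambda>x. cos (u x) * (\<Sum>j. (-1) ^ j * g (2 * j) x) +
               sin (u x) * (\<Sum>j. (-1) ^ j * g (2 * j + 1) x))
          has_field_derivative cos (u x0) * f x0) (at x0)" (is "(?H has_field_derivative _) _")
proof -
  have cont: "continuous_on S (g 0)" "continuous_on S u"
    using g0 u by (meson DERIV_isCont continuous_at_imp_continuous_on)+
  have null: "(\<lambda>N. g N x0) \<longlonglongrightarrow> 0"
  proof (rule limseq_even_odd)
    show "(\<lambda>j. g (2 * j) x0) \<longlonglongrightarrow> 0" "(\<lambda>j. g (2 * j + 1) x0) \<longlonglongrightarrow> 0"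
      using tendsto_norm_zero[OF summable_LIMSEQ_zero[OF even[OF S(2)]]]
        tendsto_norm_zero[OF summable_LIMSEQ_zero[OF odd[OF S(2)]]]
      by (auto simp: norm_mult norm_power intro: tendsto_norm_zero_cancel)
  qed
  obtain r where r: "r > 0" "cball x0 r \<subseteq> S"
    and unif: "uniform_limit (cball x0 r) g (\<lambda>_. 0) sequentially"
    using antiderivative_tower_uniform_null[OF S g_Suc h cont(1) null] by blast
  define P where "P J x = cos (u x) * (\<Sum>j\<le>J. (-1) ^ j * g (2 * j) x) +
    sin (u x) * (\<Sum>j\<le>J. (-1) ^ j * g (2 * j + 1) x)" for J x
  have P: "(P J has_field_derivative cos (u x) * f x + (-1) ^ J * (cos (u x) * h x * g (2 * J + 1) x))
      (at x)" if x: "x \<in> S" for J x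
  proof (induction J)
    case 0
    show ?case
      unfolding P_def
      by (auto intro!: derivative_eq_intros g0[OF x] g_Suc[OF x] u[OF x] simp: algebra_simps)
  next
    case (Suc J)
    have split: "P (Suc J) = (\<lambda>x. P J x +
        (-1) ^ Suc J * (cos (u x) * g (Suc (Suc (2 * J))) x + sin (u x) * g (Suc (Suc (Suc (2 * J)))) x))"
      by (auto simp: P_def algebra_simps)
    show ?case
      unfolding split
      by (rule derivative_eq_intros Suc g_Suc[OF x] u[OF x] refl)+ (simp add: algebra_simps)
  qed
  have "bounded ((\<lambda>x. cos (u x) * h x) ` cball x0 r)"
  proof (intro compact_imp_bounded compact_continuous_image compact_cball)
    have "continuous_on S (\<lambda>x. cos (u x) * h x)"
      by (intro continuous_intros cont h)
    then show "continuous_on (cball x0 r) (\<lambda>x. cos (u x) * h x)"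
      using r(2) by (rule continuous_on_subset)
  qed
  then obtain B where B: "B > 0" "\<And>x. x \<in> cball x0 r \<Longrightarrow> norm (cos (u x) * h x) \<le> B"
    unfolding bounded_pos by fastforce
  have deriv: "(P J has_field_derivative cos (u x) * f x + (-1) ^ J * (cos (u x) * h x * g (2 * J + 1) x))
      (at x within ball x0 r)" if "x \<in> ball x0 r" for J x
  proof -
    have "x \<in> S" using that r by auto
    then show ?thesis by (rule has_field_derivative_at_within[OF P])
  qed
  have conv: "\<exists>J0. \<forall>J x. J \<ge> J0 \<longrightarrow> x \<in> ball x0 r \<longrightarrow>
      norm (cos (u x) * f x + (-1) ^ J * (cos (u x) * h x * g (2 * J + 1) x) - cos (u x) * f x) \<le> e"
    if "0 < e" for e
  proof -
    have "0 < e / B" using B that by simp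
    with unif obtain N0 where N0: "\<And>N x. N \<ge> N0 \<Longrightarrow> x \<in> cball x0 r \<Longrightarrow> norm (g N x) < e / B"
      unfolding uniform_limit_iff eventually_sequentially dist_0_norm dist_norm diff_zero by blast
    show ?thesis
    proof (intro exI allI impI)
      fix J x
      assume J: "J \<ge> N0" and "x \<in> ball x0 r"
      then have x: "x \<in> cball x0 r" by simp
      have "norm (cos (u x) * h x) * norm (g (2 * J + 1) x) \<le> B * (e / B)"
        using B(1) J by (intro mult_mono B(2) x less_imp_le[OF N0]) auto
      then show "norm (cos (u x) * f x + (-1) ^ J * (cos (u x) * h x * g (2 * J + 1) x)
          - cos (u x) * f x) \<le> e"
        using B(1) by (simp add: norm_mult norm_power)
    qed
  qed
  have lim: "(\<lambda>J. P J x) \<longlonglongrightarrow> ?H x" if "x \<in> S" for x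
    unfolding P_def by (intro tendsto_intros summable_LIMSEQ' even odd that)
  have "x0 \<in> ball x0 r" using r(1) by simp
  with lim[OF S(2)] have start: "\<exists>x l. x \<in> ball x0 r \<and> (\<lambda>J. P J x) \<longlonglongrightarrow> l"
    by blast
  have "\<exists>G. \<forall>x\<in>ball x0 r. (\<lambda>J. P J x) \<longlonglongrightarrow> G x \<and>
      (G has_field_derivative cos (u x) * f x) (at x within ball x0 r)"
    by (rule has_complex_derivative_sequence[OF convex_ball deriv conv start])
  then obtain G where G: "\<And>x. x \<in> ball x0 r \<Longrightarrow> (\<lambda>J. P J x) \<longlonglongrightarrow> G x"
    "\<And>x. x \<in> ball x0 r \<Longrightarrow> (G has_field_derivative cos (u x) * f x) (at x within ball x0 r)"
    by blast
  have "(G has_field_derivative cos (u x0) * f x0) (at x0)"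
    using G(2)[of x0] r by (simp add: at_within_open[of x0 "ball x0 r"])
  moreover have "G x = ?H x" if x: "x \<in> ball x0 r" for x
  proof (rule LIMSEQ_unique[OF G(1)[OF x] lim])
    show "x \<in> S" using x r(2) by auto
  qed
  ultimately show ?thesis
    using r(1) by (elim has_field_derivative_transform_within_open[where S = "ball x0 r"]) auto
qed

section \<open>Divisors from quotients of Pochhammer symbols\<close>

text \<open>
  Integrating \<open>x powr (\<alpha> + m\<beta> + n\<gamma>)\<close> produces the exponent \<open>\<alpha> + m\<beta> + 1 + n\<gamma>\<close>, which is also the
  divisor that the integration introduces.
\<close>
definition exponent :: "complex \<Rightarrow> complex \<Rightarrow> complex \<Rightarrow> nat \<Rightarrow> nat \<Rightarrow> complex" where
  "exponent \<alpha> \<beta> \<gamma> m n = \<alpha> + of_nat m * \<beta> + 1 + of_nat n * \<gamma>"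

lemma hypergeo_term_scale: "hypergeo_term a b (\<mu> * z) n = hypergeo_term a b \<mu> n * z ^ n"
  by (simp add: hypergeo_term_def power_mult_distrib)

text \<open>
  Both sides of \<open>u * (u + 1)\<^sub>n = (u)\<^sub>n * (u + n)\<close> are the product \<open>u (u + 1) \<cdots> (u + n)\<close>.
\<close>
lemma pochhammer_ratio:
  fixes u :: complex
  assumes "u \<noteq> 0" "\<And>n. u + of_nat n \<noteq> 0"
  shows "pochhammer u n / pochhammer (u + 1) n = u / (u + of_nat n)"
proof -
  have "pochhammer (u + 1) n \<noteq> 0"
    using assms(2)[of "Suc _"] by (auto simp: pochhammer_eq_0_iff eq_neg_iff_add_eq_0 algebra_simps)
  moreover have "u * pochhammer (u + 1) n = pochhammer u n * (u + of_nat n)"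
    by (metis pochhammer_Suc pochhammer_rec)
  ultimately show ?thesis
    using assms(2)[of n] by (simp add: field_simps)
qed

lemma prod_list_extra_params:
  "(\<Prod>u\<leftarrow>extra_params \<alpha> \<beta> \<gamma> N. f u) = (\<Prod>m\<le>N. f (exponent \<alpha> \<beta> \<gamma> m 0 / \<gamma>))"
proof -
  have "(\<Prod>u\<leftarrow>extra_params \<alpha> \<beta> \<gamma> N. f u) = (\<Prod>m\<leftarrow>[0..<Suc N]. f (exponent \<alpha> \<beta> \<gamma> m 0 / \<gamma>))"
    by (simp add: extra_params_def exponent_def o_def)
  also have "\<dots> = (\<Prod>m\<in>set [0..<Suc N]. f (exponent \<alpha> \<beta> \<gamma> m 0 / \<gamma>))"
    by (rule prod.distinct_set_conv_list [symmetric]) simp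
  finally show ?thesis by (simp add: atLeast0_lessThan_Suc_eq_insert_0 lessThan_Suc_atMost atLeast0LessThan del: upt_Suc)
qed

text \<open>
  The additional lower parameters exceed the upper ones by \<open>1\<close>, so each pair of Pochhammer symbols
  telescopes to the quotient of two exponents.
\<close>
lemma hypergeo_term_extra_params:
  assumes \<gamma>: "\<gamma> \<noteq> 0" and nz: "\<And>m n. exponent \<alpha> \<beta> \<gamma> m n \<noteq> 0"
  shows "hypergeo_term (a @ extra_params \<alpha> \<beta> \<gamma> N) (b @ extra_params (\<alpha> + \<gamma>) \<beta> \<gamma> N) z n =
    (\<Prod>m\<le>N. exponent \<alpha> \<beta> \<gamma> m 0) * (hypergeo_term a b z n / (\<Prod>m\<le>N. exponent \<alpha> \<beta> \<gamma> m n))"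
proof -
  have ratio: "pochhammer (exponent \<alpha> \<beta> \<gamma> m 0 / \<gamma>) n / pochhammer (exponent (\<alpha> + \<gamma>) \<beta> \<gamma> m 0 / \<gamma>) n =
      exponent \<alpha> \<beta> \<gamma> m 0 / exponent \<alpha> \<beta> \<gamma> m n" for m
  proof -
    have shift: "exponent \<alpha> \<beta> \<gamma> m 0 / \<gamma> + of_nat k = exponent \<alpha> \<beta> \<gamma> m k / \<gamma>" for k
      using \<gamma> by (simp add: exponent_def field_simps)
    have "exponent (\<alpha> + \<gamma>) \<beta> \<gamma> m 0 / \<gamma> = exponent \<alpha> \<beta> \<gamma> m 0 / \<gamma> + 1"
      using \<gamma> by (simp add: exponent_def field_simps)
    then show ?thesis
      using pochhammer_ratio[of "exponent \<alpha> \<beta> \<gamma> m 0 / \<gamma>" n] \<gamma> nz by (simp add: shift)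
  qed
  have "hypergeo_term (a @ extra_params \<alpha> \<beta> \<gamma> N) (b @ extra_params (\<alpha> + \<gamma>) \<beta> \<gamma> N) z n =
    hypergeo_term a b z n *
      (\<Prod>m\<le>N. pochhammer (exponent \<alpha> \<beta> \<gamma> m 0 / \<gamma>) n / pochhammer (exponent (\<alpha> + \<gamma>) \<beta> \<gamma> m 0 / \<gamma>) n)"
    by (simp add: hypergeo_term_def prod_list_extra_params prod_dividef mult_ac)
  also have "\<dots> = hypergeo_term a b z n *
      ((\<Prod>m\<le>N. exponent \<alpha> \<beta> \<gamma> m 0) / (\<Prod>m\<le>N. exponent \<alpha> \<beta> \<gamma> m n))"
    by (simp only: ratio prod_dividef)
  finally show ?thesis by simp
qed

section \<open>Lower bounds for the divisors\<close>

lemma bounded_away_if_finite_small_values: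
  fixes f :: "'a \<Rightarrow> complex"
  assumes "\<And>p. f p \<noteq> 0" "finite (f ` {p. norm (f p) < 1})"
  obtains \<epsilon> where "\<epsilon> > 0" "\<And>p. \<epsilon> \<le> norm (f p)"
proof
  let ?V = "insert 1 (norm ` f ` {p. norm (f p) < 1})"
  have V: "finite ?V" using assms(2) by simp
  show "Min ?V > 0" using V assms(1) by (subst Min_gr_iff) auto
  show "Min ?V \<le> norm (f p)" for p
  proof (cases "norm (f p) < 1")
    case True
    then show ?thesis using V by (intro Min_le) auto
  next
    case False
    have "Min ?V \<le> 1" using V by (intro Min_le) auto
    with False show ?thesis by simp
  qed
qed

text \<open>
  If \<open>\<tau>\<close> is a negative rational with denominator \<open>j\<close>, infinitely many pairs \<open>(m, n)\<close> may give a
  small value, but the values lie in a translate of the integer multiples of \<open>1 / j\<close>, a discrete set.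
  Otherwise \<open>\<tau>\<close> is positive or not real, and only finitely many pairs give a small value: the real
  part of \<open>\<sigma> + m\<tau> + n\<close> (for positive \<open>\<tau>\<close>) or its imaginary part (for non-real \<open>\<tau>\<close>) bounds \<open>m\<close>, and then
  the real part bounds \<open>n\<close>.
\<close>
lemma finite_small_values:
  fixes \<sigma> \<tau> :: complex
  assumes "\<tau> \<noteq> 0" "\<not> (\<tau> \<in> \<real> - \<rat> \<and> Re \<tau> < 0)"
  shows "finite ((\<lambda>(m, n). \<sigma> + of_nat m * \<tau> + of_nat n) `
           {p. norm ((\<lambda>(m, n). \<sigma> + of_nat m * \<tau> + of_nat n) p) < 1})"
    (is "finite (?f ` ?P)")
proof (cases "\<tau> \<in> \<rat> \<and> Re \<tau> < 0")
  case True
  then obtain r where r: "\<tau> = of_rat r" by (auto elim: Rats_cases)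
  obtain i j where ij: "quotient_of r = (i, j)" by force
  have j: "j > 0" using ij quotient_of_denom_pos by blast
  have \<tau>: "\<tau> = of_int i / of_int j"
    using quotient_of_div[OF ij] r by (simp add: of_rat_divide)
  define L where "L = \<lceil>of_int j * (1 + norm \<sigma>)\<rceil>"
  have "?f ` ?P \<subseteq> (\<lambda>k. \<sigma> + of_int k / of_int j) ` {-L..L}"
  proof (rule image_subsetI)
    fix p assume p: "p \<in> ?P"
    obtain m n where mn: "p = (m, n)" by force
    define k where "k = int m * i + int n * j"
    have eq: "?f p = \<sigma> + of_int k / of_int j"
      using j by (simp add: mn k_def \<tau> field_simps)
    have "norm (of_int k / of_int j :: complex) \<le> norm (?f p) + norm \<sigma>"
      unfolding eq using norm_triangle_ineq4[of "\<sigma> + of_int k / of_int j" \<sigma>] by simp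
    with p have "norm (of_int k / of_int j :: complex) \<le> 1 + norm \<sigma>" by simp
    then have "\<bar>of_int k :: real\<bar> \<le> of_int j * (1 + norm \<sigma>)"
      using j by (simp add: norm_divide field_simps)
    then have "\<bar>k\<bar> \<le> L" unfolding L_def by linarith
    then show "?f p \<in> (\<lambda>k. \<sigma> + of_int k / of_int j) ` {-L..L}"
      unfolding eq by (intro imageI) auto
  qed
  then show ?thesis by (rule finite_subset) simp
next
  case False
  have "\<exists>X. \<forall>(m, n) \<in> ?P. real m \<le> X"
  proof (cases "Im \<tau> = 0")
    case True
    with False assms have "Re \<tau> > 0"
      by (auto simp: complex_is_Real_iff complex_eq_iff not_less less_le)
    have "real m \<le> (1 + \<bar>Re \<sigma>\<bar>) / Re \<tau>" if "(m, n) \<in> ?P" for m n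
    proof -
      have "\<bar>Re \<sigma> + real m * Re \<tau> + real n\<bar> < 1"
        using that abs_Re_le_cmod[of "?f (m, n)"] by simp
      then have "real m * Re \<tau> \<le> 1 + \<bar>Re \<sigma>\<bar>" by linarith
      with \<open>Re \<tau> > 0\<close> show ?thesis by (simp add: field_simps)
    qed
    then show ?thesis by blast
  next
    case False
    have "real m \<le> (1 + \<bar>Im \<sigma>\<bar>) / \<bar>Im \<tau>\<bar>" if "(m, n) \<in> ?P" for m n
    proof -
      have "\<bar>Im \<sigma> + real m * Im \<tau>\<bar> < 1"
        using that abs_Im_le_cmod[of "?f (m, n)"] by simp
      then have "\<bar>real m * Im \<tau>\<bar> \<le> 1 + \<bar>Im \<sigma>\<bar>" by linarith
      with False show ?thesis by (simp add: field_simps abs_mult)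
    qed
    then show ?thesis by blast
  qed
  then obtain X where X: "\<And>m n. (m, n) \<in> ?P \<Longrightarrow> real m \<le> X" by blast
  define Y where "Y = 1 + \<bar>Re \<sigma>\<bar> + X * \<bar>Re \<tau>\<bar>"
  have "real n \<le> Y" if "(m, n) \<in> ?P" for m n
  proof -
    have "\<bar>Re \<sigma> + real m * Re \<tau> + real n\<bar> < 1"
      using that abs_Re_le_cmod[of "?f (m, n)"] by simp
    then have "real n \<le> 1 + \<bar>Re \<sigma>\<bar> + \<bar>real m * Re \<tau>\<bar>" by linarith
    also have "\<bar>real m * Re \<tau>\<bar> \<le> X * \<bar>Re \<tau>\<bar>"
      using X[OF that] by (simp add: abs_mult mult_right_mono)
    finally show ?thesis by (simp add: Y_def)
  qed
  with X have "?P \<subseteq> {..nat \<lfloor>X\<rfloor>} \<times> {..nat \<lfloor>Y\<rfloor>}"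
    by (intro subsetI) (metis (no_types, lifting) SigmaI atMost_iff le_nat_floor surj_pair)
  then show ?thesis by (intro finite_imageI) (rule finite_subset, auto)
qed

lemma exponent_bounded_away:
  assumes "\<gamma> \<noteq> 0" "\<beta> \<noteq> 0" and nz: "\<And>m n. exponent \<alpha> \<beta> \<gamma> m n \<noteq> 0"
    and "\<not> (\<beta> / \<gamma> \<in> \<real> - \<rat> \<and> Re (\<beta> / \<gamma>) < 0)"
  obtains \<epsilon> where "\<epsilon> > 0" "\<And>m n. \<epsilon> \<le> norm (exponent \<alpha> \<beta> \<gamma> m n)"
proof -
  let ?f = "\<lambda>(m, n). (\<alpha> + 1) / \<gamma> + of_nat m * (\<beta> / \<gamma>) + of_nat n"
  have exponent: "exponent \<alpha> \<beta> \<gamma> m n = \<gamma> * ?f (m, n)" for m n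
    using assms(1) by (simp add: exponent_def field_simps)
  have "?f p \<noteq> 0" for p
    using nz[of "fst p" "snd p"] by (auto simp: exponent case_prod_unfold)
  moreover have "finite (?f ` {p. norm (?f p) < 1})"
    using assms by (intro finite_small_values) auto
  ultimately obtain \<epsilon> where \<epsilon>: "\<epsilon> > 0" "\<And>p. \<epsilon> \<le> norm (?f p)"
    using bounded_away_if_finite_small_values[of ?f] by blast
  show ?thesis
  proof (rule that)
    show "norm \<gamma> * \<epsilon> > 0" using \<epsilon> assms by simp
    show "norm \<gamma> * \<epsilon> \<le> norm (exponent \<alpha> \<beta> \<gamma> m n)" for m n
      unfolding exponent norm_mult by (intro mult_left_mono \<epsilon>) simp
  qed
qed

text \<open>
  For fixed \<open>n\<close> the exponents form an arithmetic progression with difference \<open>\<beta>\<close>, and two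
  of modulus less than \<open>K\<close> differ by less than \<open>2K\<close>.  Hence the bound depends neither on \<open>n\<close>
  nor on \<open>N\<close>.
\<close>
lemma card_small_exponent_bounded:
  assumes "\<beta> \<noteq> 0"
  obtains M where "\<And>N n. card {m. m < N \<and> norm (exponent \<alpha> \<beta> \<gamma> m n) < K} \<le> M"
proof
  fix N n
  let ?B = "{m. m < N \<and> norm (exponent \<alpha> \<beta> \<gamma> m n) < K}"
  define L where "L = nat \<lfloor>2 * K / norm \<beta>\<rfloor>"
  show "card ?B \<le> Suc L"
  proof (cases "?B = {}")
    case True
    then show ?thesis by (simp only: card.empty)
  next
    case False
    define m0 where "m0 = Min ?B"
    have m0: "m0 \<in> ?B" unfolding m0_def using False by (intro Min_in) auto
    have "?B \<subseteq> {m0..m0 + L}"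
    proof
      fix m assume m: "m \<in> ?B"
      have le: "m0 \<le> m" unfolding m0_def using m by (intro Min_le) auto
      have "of_nat (m - m0) * \<beta> = exponent \<alpha> \<beta> \<gamma> m n - exponent \<alpha> \<beta> \<gamma> m0 n"
        using le by (simp add: exponent_def of_nat_diff algebra_simps)
      then have "real (m - m0) * norm \<beta> = norm (exponent \<alpha> \<beta> \<gamma> m n - exponent \<alpha> \<beta> \<gamma> m0 n)"
        by (metis norm_mult norm_of_nat)
      also have "\<dots> \<le> 2 * K"
        using norm_triangle_ineq4[of "exponent \<alpha> \<beta> \<gamma> m n" "exponent \<alpha> \<beta> \<gamma> m0 n"] m m0 by simp
      finally have "real (m - m0) \<le> 2 * K / norm \<beta>" using assms by (simp add: field_simps)
      then have "m - m0 \<le> L" unfolding L_def by (rule le_nat_floor)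
      with le show "m \<in> {m0..m0 + L}" by auto
    qed
    then have "card ?B \<le> card {m0..m0 + L}" by (rule card_mono[rotated]) simp
    then show ?thesis by simp
  qed
qed

text \<open>
  All but boundedly many factors have modulus at least \<open>K\<close>, and the others at least \<open>\<epsilon>\<close>.  As \<open>K\<close> is
  arbitrary, the products grow faster than any geometric sequence, uniformly in \<open>n\<close>.
\<close>
lemma prod_exponent_lower_bound:
  assumes "\<beta> \<noteq> 0" and \<epsilon>: "\<epsilon> > 0" "\<And>m n. \<epsilon> \<le> norm (exponent \<alpha> \<beta> \<gamma> m n)" and K: "K > 0"
  obtains C where "C > 0" "\<And>N n. C * K ^ N \<le> norm (\<Prod>m<N. exponent \<alpha> \<beta> \<gamma> m n)"
proof -
  obtain M where M: "\<And>N n. card {m. m < N \<and> norm (exponent \<alpha> \<beta> \<gamma> m n) < K} \<le> M"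
    using card_small_exponent_bounded[OF assms(1)] by blast
  define q where "q = min 1 (\<epsilon> / K)"
  have q: "0 < q" "q \<le> 1" "q * K \<le> \<epsilon>" using \<epsilon> K by (auto simp: q_def min_def field_simps)
  show ?thesis
  proof (rule that)
    show "q ^ M > 0" using q by simp
    fix N n
    let ?B = "{m. m < N \<and> norm (exponent \<alpha> \<beta> \<gamma> m n) < K}"
    let ?c = "\<lambda>m. if norm (exponent \<alpha> \<beta> \<gamma> m n) < K then q else 1"
    have "q ^ M * K ^ N \<le> q ^ card ?B * K ^ N"
      using q K M[of N n] by (intro mult_right_mono power_decreasing) auto
    also have "q ^ card ?B = (\<Prod>m<N. ?c m)"
    proof -
      have "{..<N} \<inter> {m. norm (exponent \<alpha> \<beta> \<gamma> m n) < K} = ?B" by auto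
      then show ?thesis by (simp add: prod.If_cases)
    qed
    also have "(\<Prod>m<N. ?c m) * K ^ N = (\<Prod>m<N. ?c m * K)"
      by (simp add: prod.distrib)
    also have "\<dots> \<le> (\<Prod>m<N. norm (exponent \<alpha> \<beta> \<gamma> m n))"
    proof (intro prod_mono conjI)
      fix m
      show "0 \<le> ?c m * K" using q K by simp
      show "?c m * K \<le> norm (exponent \<alpha> \<beta> \<gamma> m n)" using q(3) \<epsilon>(2)[of m n] by auto
    qed
    finally show "q ^ M * K ^ N \<le> norm (\<Prod>m<N. exponent \<alpha> \<beta> \<gamma> m n)"
      by (simp add: prod_norm)
  qed
qed

section \<open>Integrated power series\<close>

text \<open>
  The \<open>k\<close>-fold integrated series: with \<open>z = x powr \<gamma>\<close>, each integration divides the term of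
  index \<open>n\<close> by the exponent that it produces.  For \<open>k = 0\<close> and hypergeometric coefficients this is
  the given hypergeometric function; for \<open>k = N + 1\<close> it is \<open>F\<^sub>N\<close> divided by the product of the
  \<open>\<alpha> + m\<beta> + 1\<close>.
\<close>
definition integrated_series :: "(nat \<Rightarrow> complex) \<Rightarrow> complex \<Rightarrow> complex \<Rightarrow> complex \<Rightarrow> nat \<Rightarrow> complex \<Rightarrow> complex" where
  "integrated_series d \<alpha> \<beta> \<gamma> k z = (\<Sum>n. d n / (\<Prod>m<k. exponent \<alpha> \<beta> \<gamma> m n) * z ^ n)"

text \<open>
  For a fixed number of factors the divisors tend to infinity with \<open>n\<close>, so integration does not
  disturb the convergence of the power series.
\<close>
lemma Bseq_inverse_prod_exponent:
  assumes "\<gamma> \<noteq> 0"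
  shows "Bseq (\<lambda>n. inverse (\<Prod>m<k. exponent \<alpha> \<beta> \<gamma> m n))"
proof (induction k)
  case 0
  show ?case by simp
next
  case (Suc k)
  have "filterlim (\<lambda>n. exponent \<alpha> \<beta> \<gamma> k n) at_infinity sequentially"
    unfolding exponent_def mult.commute[of _ \<gamma>]
    by (intro tendsto_add_filterlim_at_infinity[OF tendsto_const]
        tendsto_mult_filterlim_at_infinity[OF tendsto_const] tendsto_of_nat assms)
  then have "(\<lambda>n. inverse (exponent \<alpha> \<beta> \<gamma> k n)) \<longlonglongrightarrow> 0"
    by (rule filterlim_compose[OF tendsto_inverse_0])
  then have "Bseq (\<lambda>n. inverse (exponent \<alpha> \<beta> \<gamma> k n))"
    by (intro convergent_imp_Bseq convergentI)
  from Bseq_mult[OF Suc this] show ?case by (simp add: mult.commute)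
qed

lemma summable_integrated_series:
  assumes "\<gamma> \<noteq> 0" "summable (\<lambda>n. norm (d n * z ^ n))"
  shows "summable (\<lambda>n. norm (d n / (\<Prod>m<k. exponent \<alpha> \<beta> \<gamma> m n) * z ^ n))"
proof -
  obtain B where B: "\<And>n. norm (inverse (\<Prod>m<k. exponent \<alpha> \<beta> \<gamma> m n)) \<le> B"
    using Bseq_inverse_prod_exponent[OF assms(1)] unfolding Bseq_def by blast
  show ?thesis
  proof (rule summable_comparison_test')
    show "summable (\<lambda>n. B * norm (d n * z ^ n))" by (intro summable_mult assms)
    show "norm (norm (d n / (\<Prod>m<k. exponent \<alpha> \<beta> \<gamma> m n) * z ^ n)) \<le> B * norm (d n * z ^ n)"
      if "n \<ge> 0" for n
      using mult_right_mono[OF B[of n], of "norm (d n * z ^ n)"]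
      by (simp add: field_simps norm_mult norm_divide norm_inverse)
  qed
qed

text \<open>
  The operator \<open>exponent k 0 + \<gamma> z d/dz\<close> multiplies \<open>z ^ n\<close> by the exponent \<open>exponent k n\<close> and so cancels the
  last divisor.  The equation is stated through the derivative \<open>D\<close> in order to be used with the chain
  rule.
\<close>
lemma integrated_series_differential_equation:
  assumes \<gamma>: "\<gamma> \<noteq> 0" and K: "summable (\<lambda>n. norm (d n * K ^ n))" "norm z < norm K"
    and nz: "\<And>n. exponent \<alpha> \<beta> \<gamma> k n \<noteq> 0"
  obtains D where "(integrated_series d \<alpha> \<beta> \<gamma> (Suc k) has_field_derivative D) (at z)"
    and "exponent \<alpha> \<beta> \<gamma> k 0 * integrated_series d \<alpha> \<beta> \<gamma> (Suc k) z + \<gamma> * z * D = integrated_series d \<alpha> \<beta> \<gamma> k z"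
proof
  define c where "c n = d n / (\<Prod>m<Suc k. exponent \<alpha> \<beta> \<gamma> m n)" for n
  have integrated_series_eq: "integrated_series d \<alpha> \<beta> \<gamma> (Suc k) = (\<lambda>z. \<Sum>n. c n * z ^ n)"
    unfolding integrated_series_def c_def ..
  have cK: "summable (\<lambda>n. c n * K ^ n)"
    unfolding c_def by (rule summable_norm_cancel[OF summable_integrated_series[OF \<gamma> K(1)]])
  show "(integrated_series d \<alpha> \<beta> \<gamma> (Suc k) has_field_derivative (\<Sum>n. diffs c n * z ^ n)) (at z)"
    unfolding integrated_series_eq by (rule termdiffs_strong[OF cK K(2)])
  have inside: "summable (\<lambda>n. c n * w ^ n)" if "norm w < norm K" for w
    by (rule summable_norm_cancel[OF powser_insidea[OF cK that]])
  have "(\<lambda>n. of_nat n * c n * z ^ (n - Suc 0)) sums (\<Sum>n. diffs c n * z ^ n)"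
    by (rule diffs_equiv[OF termdiff_converges[OF K(2) inside]])
  from sums_mult[OF this, of "\<gamma> * z"]
  have "(\<lambda>n. \<gamma> * of_nat n * c n * z ^ n) sums (\<gamma> * z * (\<Sum>n. diffs c n * z ^ n))"
  proof (rule sums_cong[THEN iffD1, rotated])
    show "\<gamma> * z * (of_nat n * c n * z ^ (n - Suc 0)) = \<gamma> * of_nat n * c n * z ^ n" for n
      by (cases n) (simp_all add: mult_ac)
  qed
  moreover have "(\<lambda>n. exponent \<alpha> \<beta> \<gamma> k 0 * (c n * z ^ n)) sums (exponent \<alpha> \<beta> \<gamma> k 0 * integrated_series d \<alpha> \<beta> \<gamma> (Suc k) z)"
    unfolding integrated_series_eq by (intro sums_mult summable_sums inside K)
  ultimately have "(\<lambda>n. exponent \<alpha> \<beta> \<gamma> k 0 * (c n * z ^ n) + \<gamma> * of_nat n * c n * z ^ n) sums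
      (exponent \<alpha> \<beta> \<gamma> k 0 * integrated_series d \<alpha> \<beta> \<gamma> (Suc k) z + \<gamma> * z * (\<Sum>n. diffs c n * z ^ n))"
    by (rule sums_add[rotated])
  moreover have "exponent \<alpha> \<beta> \<gamma> k 0 * (c n * z ^ n) + \<gamma> * of_nat n * c n * z ^ n =
      d n / (\<Prod>m<k. exponent \<alpha> \<beta> \<gamma> m n) * z ^ n" for n
  proof -
    have "exponent \<alpha> \<beta> \<gamma> k 0 * (c n * z ^ n) + \<gamma> * of_nat n * c n * z ^ n = exponent \<alpha> \<beta> \<gamma> k n * c n * z ^ n"
      by (simp add: exponent_def algebra_simps)
    also have "exponent \<alpha> \<beta> \<gamma> k n * c n = d n / (\<Prod>m<k. exponent \<alpha> \<beta> \<gamma> m n)"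
      using nz[of n] by (simp add: c_def)
    finally show ?thesis .
  qed
  ultimately show "exponent \<alpha> \<beta> \<gamma> k 0 * integrated_series d \<alpha> \<beta> \<gamma> (Suc k) z + \<gamma> * z * (\<Sum>n. diffs c n * z ^ n) =
      integrated_series d \<alpha> \<beta> \<gamma> k z"
    by (simp add: integrated_series_def sums_iff)
qed

lemma integrated_series_bound:
  assumes d: "summable (\<lambda>n. norm (d n * z ^ n))"
    and L: "L > 0" "\<And>n. L \<le> norm (\<Prod>m<k. exponent \<alpha> \<beta> \<gamma> m n)"
  shows "norm (integrated_series d \<alpha> \<beta> \<gamma> k z) \<le> (\<Sum>n. norm (d n * z ^ n)) / L"
proof -
  have le: "norm (d n / (\<Prod>m<k. exponent \<alpha> \<beta> \<gamma> m n) * z ^ n) \<le> norm (d n * z ^ n) / L" for n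
    using frac_le[OF norm_ge_zero order_refl L(1) L(2)[of n], of "d n * z ^ n"]
    by (simp add: norm_mult norm_divide)
  have sum: "summable (\<lambda>n. norm (d n * z ^ n) / L)" by (intro summable_divide d)
  have "summable (\<lambda>n. norm (d n / (\<Prod>m<k. exponent \<alpha> \<beta> \<gamma> m n) * z ^ n))"
    by (rule summable_comparison_test'[OF sum]) (simp only: real_norm_def abs_norm_cancel le)
  from summable_norm[OF this] suminf_le[OF le this sum] show ?thesis
    unfolding integrated_series_def suminf_divide[OF d] by linarith
qed

text \<open>
  In the logarithmic coordinate \<open>Ln x\<close>, moving in the direction \<open>1 / s\<close> multiplies \<open>x powr s\<close> by a real
  factor greater than \<open>1\<close>.  Off the branch cut a short such move causes no jump of the principal
  value.
\<close>
lemma powr_abs_increasing_nearby: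
  fixes x s :: complex
  assumes "s \<noteq> 0" "open S" "x \<in> S" "x \<notin> \<real>\<^sub>\<le>\<^sub>0"
  obtains y where "y \<in> S" "norm (x powr s) < norm (y powr s)"
proof -
  define p where "p w = Ln x + of_real w / s" for w :: real
  have x: "x \<noteq> 0" using assms(4) by auto
  have p: "(p \<longlongrightarrow> Ln x) (at_right 0)"
    unfolding p_def using assms(1) by (auto intro!: tendsto_eq_intros)
  have "((\<lambda>w. exp (p w)) \<longlongrightarrow> x) (at_right 0)"
    using tendsto_exp[OF p] x by simp
  then have "\<forall>\<^sub>F w in at_right 0. exp (p w) \<in> S"
    using assms(2,3) by (rule topological_tendstoD)
  moreover have "\<bar>Im (Ln x)\<bar> < pi"
    using x assms(4) Im_Ln_less_pi mpi_less_Im_Ln[OF x]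
    by (simp add: abs_less_iff complex_nonpos_Reals_iff)
  then have "\<forall>\<^sub>F w in at_right 0. \<bar>Im (p w)\<bar> < pi"
    by (intro order_tendstoD(2)[OF tendsto_rabs[OF tendsto_Im[OF p]]])
  moreover have "\<forall>\<^sub>F w in at_right (0::real). w > 0"
    by (simp add: eventually_at_filter)
  ultimately have "\<forall>\<^sub>F w in at_right 0. exp (p w) \<in> S \<and> \<bar>Im (p w)\<bar> < pi \<and> w > 0"
    by eventually_elim simp
  then obtain w where w: "exp (p w) \<in> S" "\<bar>Im (p w)\<bar> < pi" "w > 0"
    using eventually_happens'[OF trivial_limit_at_right_real] by blast
  have "exp (p w) powr s = exp (s * p w)"
    using w(2) by (simp add: powr_def)
  also have "\<dots> = exp (of_real w) * x powr s"
    using x assms(1) by (simp add: powr_def p_def exp_add[symmetric] algebra_simps)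
  finally have "norm (exp (p w) powr s) = exp w * norm (x powr s)"
    by (simp add: norm_mult)
  moreover have "norm (x powr s) > 0" using x by simp
  ultimately show ?thesis
    using w by (intro that[of "exp (p w)"]) auto
qed

text \<open>
  Convergence on an open set is convergence strictly inside the disc, hence absolute: near each point
  there is another one where the modulus of the argument is larger.
\<close>
lemma power_series_in_powr_summable_norm:
  fixes x \<gamma> :: complex and d :: "nat \<Rightarrow> complex"
  assumes "\<gamma> \<noteq> 0" "open S" "S \<inter> \<real>\<^sub>\<le>\<^sub>0 = {}" "x \<in> S"
    and "\<And>x. x \<in> S \<Longrightarrow> summable (\<lambda>n. d n * (x powr \<gamma>) ^ n)"
  shows "summable (\<lambda>n. norm (d n * (x powr \<gamma>) ^ n))"
proof -
  have "x \<notin> \<real>\<^sub>\<le>\<^sub>0" using assms(3,4) by blast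
  from powr_abs_increasing_nearby[OF assms(1,2,4) this] obtain y
    where "y \<in> S" "norm (x powr \<gamma>) < norm (y powr \<gamma>)" .
  then show ?thesis using powser_insidea assms(5) by blast
qed

section \<open>The terms of the cosine and sine series\<close>

lemma F_fun_eq_integrated_series:
  assumes "\<gamma> \<noteq> 0" "\<And>m n. exponent \<alpha> \<beta> \<gamma> m n \<noteq> 0"
    and conv: "summable (\<lambda>n. norm (hypergeo_term a b \<mu> n * (x powr \<gamma>) ^ n))"
  shows "summable (hypergeo_term (a @ extra_params \<alpha> \<beta> \<gamma> N)
           (b @ extra_params (\<alpha> + \<gamma>) \<beta> \<gamma> N) (\<mu> * x powr \<gamma>))"
    and "F_fun a b \<alpha> \<beta> \<gamma> \<mu> N x = (\<Prod>m\<le>N. exponent \<alpha> \<beta> \<gamma> m 0) *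
           integrated_series (hypergeo_term a b \<mu>) \<alpha> \<beta> \<gamma> (Suc N) (x powr \<gamma>)"
proof -
  let ?t = "\<lambda>n. hypergeo_term a b \<mu> n / (\<Prod>m<Suc N. exponent \<alpha> \<beta> \<gamma> m n) * (x powr \<gamma>) ^ n"
  have eq: "hypergeo_term (a @ extra_params \<alpha> \<beta> \<gamma> N) (b @ extra_params (\<alpha> + \<gamma>) \<beta> \<gamma> N) (\<mu> * x powr \<gamma>) =
      (\<lambda>n. (\<Prod>m\<le>N. exponent \<alpha> \<beta> \<gamma> m 0) * ?t n)"
    by (rule ext) (simp only: hypergeo_term_extra_params[OF assms(1,2)] hypergeo_term_scale
        times_divide_eq_left lessThan_Suc_atMost mult.assoc)
  have t: "summable ?t"
    by (rule summable_norm_cancel[OF summable_integrated_series[OF assms(1) conv]])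
  show "summable (hypergeo_term (a @ extra_params \<alpha> \<beta> \<gamma> N)
      (b @ extra_params (\<alpha> + \<gamma>) \<beta> \<gamma> N) (\<mu> * x powr \<gamma>))"
    unfolding eq by (rule summable_mult[OF t])
  show "F_fun a b \<alpha> \<beta> \<gamma> \<mu> N x = (\<Prod>m\<le>N. exponent \<alpha> \<beta> \<gamma> m 0) *
      integrated_series (hypergeo_term a b \<mu>) \<alpha> \<beta> \<gamma> (Suc N) (x powr \<gamma>)"
    unfolding F_fun_def hypergeo_def eq integrated_series_def by (rule suminf_mult[OF t])
qed

lemma trig_term_eq_integrated_series:
  assumes "\<gamma> \<noteq> 0" and nz: "\<And>m n. exponent \<alpha> \<beta> \<gamma> m n \<noteq> 0"
    and "summable (\<lambda>n. norm (hypergeo_term a b \<mu> n * (x powr \<gamma>) ^ n))"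
  shows "trig_term a b \<alpha> \<beta> \<gamma> \<eta> \<mu> x N =
    (\<beta> * \<eta> * x powr \<beta>) ^ N * integrated_series (hypergeo_term a b \<mu>) \<alpha> \<beta> \<gamma> (Suc N) (x powr \<gamma>)"
proof -
  have "(\<Prod>m=0..N. \<alpha> + of_nat m * \<beta> + 1) = (\<Prod>m\<le>N. exponent \<alpha> \<beta> \<gamma> m 0)"
    by (simp add: exponent_def atLeast0AtMost)
  then show ?thesis
    using nz by (simp add: trig_term_def F_fun_eq_integrated_series[OF assms])
qed

text \<open>
  The outer series converge: the divisors outgrow every geometric sequence, in particular the powers
  of \<open>y\<close>.
\<close>
lemma integrated_series_geometric_decay:
  assumes "\<gamma> \<noteq> 0" "\<beta> \<noteq> 0" and nz: "\<And>m n. exponent \<alpha> \<beta> \<gamma> m n \<noteq> 0"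
    and "\<not> (\<beta> / \<gamma> \<in> \<real> - \<rat> \<and> Re (\<beta> / \<gamma>) < 0)"
    and d: "summable (\<lambda>n. norm (d n * z ^ n))"
  obtains B where "\<And>N. norm (y ^ N * integrated_series d \<alpha> \<beta> \<gamma> (Suc N) z) \<le> B * (1 / 2) ^ N"
proof -
  obtain \<epsilon> where \<epsilon>: "\<epsilon> > 0" "\<And>m n. \<epsilon> \<le> norm (exponent \<alpha> \<beta> \<gamma> m n)"
    using exponent_bounded_away[OF assms(1-4)] by blast
  \<comment> \<open>This choice makes \<open>norm y / K \<le> 1/2\<close>; \<open>K \<ge> 1\<close> absorbs the extra factor of the product.\<close>
  define K where "K = 2 * norm y + 1"
  have K: "K \<ge> 1" by (simp add: K_def)
  then have "K > 0" by simp
  from prod_exponent_lower_bound[OF assms(2) \<epsilon> this] obtain C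
    where C: "C > 0" "\<And>N n. C * K ^ N \<le> norm (\<Prod>m<N. exponent \<alpha> \<beta> \<gamma> m n)"
    by blast
  define A where "A = (\<Sum>n. norm (d n * z ^ n))"
  have A: "A \<ge> 0" unfolding A_def by (intro suminf_nonneg d) simp
  show ?thesis
  proof (rule that)
    fix N
    have "norm (integrated_series d \<alpha> \<beta> \<gamma> (Suc N) z) \<le> A / (C * K ^ Suc N)"
      unfolding A_def using \<open>K > 0\<close> by (intro integrated_series_bound d C(2)) (simp add: C(1))
    also have "\<dots> \<le> A / (C * K ^ N)"
      using K C A by (intro divide_left_mono mult_left_mono power_increasing) auto
    finally have "norm (y ^ N * integrated_series d \<alpha> \<beta> \<gamma> (Suc N) z) \<le> norm y ^ N * (A / (C * K ^ N))"
      by (simp add: norm_mult norm_power mult_left_mono del: times_divide_eq_right)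
    also have "\<dots> = A / C * (norm y / K) ^ N"
      by (simp add: power_divide)
    also have "\<dots> \<le> A / C * (1 / 2) ^ N"
    proof (intro mult_left_mono power_mono)
      show "norm y / K \<le> 1 / 2"
        unfolding pos_divide_le_eq[OF \<open>K > 0\<close>] by (simp add: K_def)
    qed (use A C K in auto)
    finally show "norm (y ^ N * integrated_series d \<alpha> \<beta> \<gamma> (Suc N) z) \<le> A / C * (1 / 2) ^ N" .
  qed
qed

lemma summable_alternating_subsequence:
  fixes t :: "nat \<Rightarrow> complex"
  assumes "\<And>N. norm (t N) \<le> B * (1 / 2) ^ N"
  shows "summable (\<lambda>j. (-1) ^ j * t (2 * j + i))"
proof (rule summable_comparison_test')
  show "summable (\<lambda>j. B * (1 / 2 :: real) ^ j)"
    by (intro summable_mult summable_geometric) simp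
  have "0 \<le> B" using order_trans[OF norm_ge_zero assms[of 0]] by simp
  then have "B * (1 / 2) ^ (2 * j + i) \<le> B * (1 / 2) ^ j" for j
    by (intro mult_left_mono power_decreasing) auto
  with assms show "norm ((-1) ^ j * t (2 * j + i)) \<le> B * (1 / 2) ^ j" if "j \<ge> 0" for j
    by (auto simp: norm_mult norm_power intro: order_trans)
qed

lemma trig_tower_eq_monomial:
  "x powr (\<alpha> + 1) * ((\<beta> * \<eta> * x powr \<beta>) ^ N * w) = (\<beta> * \<eta>) ^ N * (x powr exponent \<alpha> \<beta> \<gamma> N 0 * w)"
proof -
  have "(x powr \<beta>) ^ N = x powr (of_nat N * \<beta>)" if "x \<noteq> 0"
    using that by (simp add: powr_def exp_of_nat_mult[symmetric] mult_ac)
  then show ?thesis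
    by (cases "x = 0") (simp_all add: power_mult_distrib exponent_def powr_add mult_ac)
qed

text \<open>
  Differentiation removes one divisor from the integrated series and lowers the exponent by \<open>1\<close>.
  For \<open>N > 0\<close> the result is \<open>(\<eta> x\<^sup>\<beta>)'\<close> times the function with index \<open>N - 1\<close>, and for \<open>N = 0\<close> it is \<open>x\<^sup>\<alpha>\<close>
  times the original power series.
\<close>
lemma trig_tower_has_derivative:
  assumes \<gamma>: "\<gamma> \<noteq> 0" and nz: "\<And>m n. exponent \<alpha> \<beta> \<gamma> m n \<noteq> 0"
    and S: "open S" "S \<inter> \<real>\<^sub>\<le>\<^sub>0 = {}" "x \<in> S"
    and conv: "\<And>x. x \<in> S \<Longrightarrow> summable (\<lambda>n. d n * (x powr \<gamma>) ^ n)"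
  shows "((\<lambda>x. x powr (\<alpha> + 1) * ((\<beta> * \<eta> * x powr \<beta>) ^ N * integrated_series d \<alpha> \<beta> \<gamma> (Suc N) (x powr \<gamma>)))
     has_field_derivative (\<beta> * \<eta>) ^ N * (x powr (exponent \<alpha> \<beta> \<gamma> N 0 - 1) * integrated_series d \<alpha> \<beta> \<gamma> N (x powr \<gamma>))) (at x)"
proof -
  have x: "x \<notin> \<real>\<^sub>\<le>\<^sub>0" "x \<noteq> 0" using S by auto
  obtain y where y: "y \<in> S" "norm (x powr \<gamma>) < norm (y powr \<gamma>)"
    using powr_abs_increasing_nearby[OF \<gamma> S(1,3) x(1)] by blast
  let ?s = "exponent \<alpha> \<beta> \<gamma> N 0"
  obtain D where D: "(integrated_series d \<alpha> \<beta> \<gamma> (Suc N) has_field_derivative D) (at (x powr \<gamma>))"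
    and ode: "?s * integrated_series d \<alpha> \<beta> \<gamma> (Suc N) (x powr \<gamma>) + \<gamma> * x powr \<gamma> * D = integrated_series d \<alpha> \<beta> \<gamma> N (x powr \<gamma>)"
    using integrated_series_differential_equation[OF \<gamma> power_series_in_powr_summable_norm[OF \<gamma> S(1,2) y(1) conv] y(2) nz]
    by blast
  have "((\<lambda>x. (\<beta> * \<eta>) ^ N * (x powr ?s * integrated_series d \<alpha> \<beta> \<gamma> (Suc N) (x powr \<gamma>))) has_field_derivative
      (\<beta> * \<eta>) ^ N * (x powr ?s * (D * (\<gamma> * x powr (\<gamma> - 1))) +
        ?s * x powr (?s - 1) * integrated_series d \<alpha> \<beta> \<gamma> (Suc N) (x powr \<gamma>))) (at x)"
    by (intro DERIV_cmult DERIV_mult' has_field_derivative_powr x DERIV_chain2[where g = "\<lambda>x. x powr \<gamma>", OF D])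
  also have "x powr ?s * (D * (\<gamma> * x powr (\<gamma> - 1))) + ?s * x powr (?s - 1) * integrated_series d \<alpha> \<beta> \<gamma> (Suc N) (x powr \<gamma>) =
      x powr (?s - 1) * (?s * integrated_series d \<alpha> \<beta> \<gamma> (Suc N) (x powr \<gamma>) + \<gamma> * x powr \<gamma> * D)"
  proof -
    have "x powr ?s * x powr (\<gamma> - 1) = x powr (?s - 1) * x powr \<gamma>"
      by (simp only: powr_add[symmetric] add_diff_eq diff_add_eq)
    then show ?thesis by (simp add: algebra_simps)
  qed
  finally show ?thesis
    by (simp only: trig_tower_eq_monomial[where \<gamma> = \<gamma>] ode)
qed

section \<open>The antiderivative\<close>

theorem proposition4:
  fixes a b :: "complex list" and \<alpha> \<beta> \<gamma> \<eta> \<mu> :: complex and S :: "complex set"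
  assumes \<gamma>: "\<gamma> \<noteq> 0"
    and S: "open S" "connected S" "S \<inter> \<real>\<^sub>\<le>\<^sub>0 = {}"
    and pFq_converges: "\<forall>x\<in>S. summable (hypergeo_term a b (\<mu> * x powr \<gamma>))"
    and denominators: "\<forall>m::nat. \<alpha> + of_nat m * \<beta> + 1 \<noteq> 0"
    and lower_params: "\<forall>m::nat. (\<alpha> + \<gamma> + of_nat m * \<beta> + 1) / \<gamma> \<notin> \<int>\<^sub>\<le>\<^sub>0"
    (* for a negative irrational ratio the divisors \<alpha> + m\<beta> + 1 + n\<gamma> can be arbitrarily small,
       and the two outer series may diverge; for all other ratios their convergence is claimed *)
    and small_divisors: "\<beta> / \<gamma> \<in> \<real> - \<rat> \<Longrightarrow> Re (\<beta> / \<gamma>) < 0 \<Longrightarrow>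
      \<forall>x\<in>S. summable (\<lambda>j. (-1) ^ j * trig_term a b \<alpha> \<beta> \<gamma> \<eta> \<mu> x (2 * j)) \<and>
            summable (\<lambda>j. (-1) ^ j * trig_term a b \<alpha> \<beta> \<gamma> \<eta> \<mu> x (2 * j + 1))"
  shows "(\<forall>x\<in>S.
        (\<forall>N. summable (hypergeo_term (a @ extra_params \<alpha> \<beta> \<gamma> N)
               (b @ extra_params (\<alpha> + \<gamma>) \<beta> \<gamma> N) (\<mu> * x powr \<gamma>))) \<and>
        summable (\<lambda>j. (-1) ^ j * trig_term a b \<alpha> \<beta> \<gamma> \<eta> \<mu> x (2 * j)) \<and>
        summable (\<lambda>j. (-1) ^ j * trig_term a b \<alpha> \<beta> \<gamma> \<eta> \<mu> x (2 * j + 1))) \<and>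
    (\<forall>G. (\<forall>x\<in>S. (G has_field_derivative
                    x powr \<alpha> * cos (\<eta> * x powr \<beta>) * hypergeo a b (\<mu> * x powr \<gamma>)) (at x)) \<longleftrightarrow>
         (\<exists>C. \<forall>x\<in>S. G x =
            x powr (\<alpha> + 1) * cos (\<eta> * x powr \<beta>) *
              (\<Sum>j. (-1) ^ j * trig_term a b \<alpha> \<beta> \<gamma> \<eta> \<mu> x (2 * j)) +
            x powr (\<alpha> + 1) * sin (\<eta> * x powr \<beta>) *
              (\<Sum>j. (-1) ^ j * trig_term a b \<alpha> \<beta> \<gamma> \<eta> \<mu> x (2 * j + 1)) + C))"
proof -
  define d where "d = hypergeo_term a b \<mu>"
  have nz: "exponent \<alpha> \<beta> \<gamma> m n \<noteq> 0" for m n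
  proof (cases n)
    case 0
    then show ?thesis using denominators by (simp add: exponent_def)
  next
    case (Suc k)
    show ?thesis
    proof
      assume "exponent \<alpha> \<beta> \<gamma> m n = 0"
      then have "\<alpha> + \<gamma> + of_nat m * \<beta> + 1 = - of_nat k * \<gamma>"
        unfolding exponent_def Suc by (simp add: algebra_simps eq_neg_iff_add_eq_0)
      then have "(\<alpha> + \<gamma> + of_nat m * \<beta> + 1) / \<gamma> = - of_nat k"
        using \<gamma> by simp
      then show False using lower_params by (metis minus_of_nat_in_nonpos_Ints)
    qed
  qed
  have conv: "summable (\<lambda>n. d n * (x powr \<gamma>) ^ n)" if "x \<in> S" for x
    using pFq_converges that by (simp add: d_def hypergeo_term_scale[abs_def])
  note abs_conv = power_series_in_powr_summable_norm[OF \<gamma> S(1,3) _ conv]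
  have trig_term: "trig_term a b \<alpha> \<beta> \<gamma> \<eta> \<mu> x N =
      (\<beta> * \<eta> * x powr \<beta>) ^ N * integrated_series d \<alpha> \<beta> \<gamma> (Suc N) (x powr \<gamma>)" if "x \<in> S" for x N
    unfolding d_def by (rule trig_term_eq_integrated_series[OF \<gamma> nz abs_conv[OF that, unfolded d_def]])
  have outer: "summable (\<lambda>j. (-1) ^ j * trig_term a b \<alpha> \<beta> \<gamma> \<eta> \<mu> x (2 * j)) \<and>
      summable (\<lambda>j. (-1) ^ j * trig_term a b \<alpha> \<beta> \<gamma> \<eta> \<mu> x (2 * j + 1))" if x: "x \<in> S" for x
  proof (cases "\<beta> / \<gamma> \<in> \<real> - \<rat> \<and> Re (\<beta> / \<gamma>) < 0")
    case True
    then show ?thesis using small_divisors x by blast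
  next
    case regular: False
    \<comment> \<open>For \<open>\<beta> = 0\<close> the divisors do not grow with \<open>m\<close>, but all terms with \<open>N > 0\<close> vanish.\<close>
    obtain B where "\<And>N. norm (trig_term a b \<alpha> \<beta> \<gamma> \<eta> \<mu> x N) \<le> B * (1 / 2) ^ N"
    proof (cases "\<beta> = 0")
      case True
      show ?thesis
      proof (rule that)
        show "norm (trig_term a b \<alpha> \<beta> \<gamma> \<eta> \<mu> x N) \<le> norm (trig_term a b \<alpha> \<beta> \<gamma> \<eta> \<mu> x 0) * (1 / 2) ^ N" for N
          by (cases N) (simp_all add: True trig_term_def)
      qed
    next
      case False
      show ?thesis
        unfolding trig_term[OF x]
        using integrated_series_geometric_decay[OF \<gamma> False nz regular abs_conv[OF x]] that
        unfolding trig_term[OF x] by blast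
    qed
    from summable_alternating_subsequence[OF this, of 0] summable_alternating_subsequence[OF this, of 1]
    show ?thesis by simp
  qed
  \<comment> \<open>The integrand is \<open>cos u * f\<close> with \<open>u' = h\<close>; the \<open>g N\<close> are the iterated antiderivatives that
      the repeated integration by parts needs.\<close>
  define u where "u x = \<eta> * x powr \<beta>" for x
  define h where "h x = \<beta> * \<eta> * x powr (\<beta> - 1)" for x
  define g where "g N x = x powr (\<alpha> + 1) * trig_term a b \<alpha> \<beta> \<gamma> \<eta> \<mu> x N" for N x
  define f where "f x = x powr \<alpha> * hypergeo a b (\<mu> * x powr \<gamma>)" for x
  have g_deriv: "(g N has_field_derivative
      (\<beta> * \<eta>) ^ N * (x powr (exponent \<alpha> \<beta> \<gamma> N 0 - 1) * integrated_series d \<alpha> \<beta> \<gamma> N (x powr \<gamma>))) (at x)"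
    if x: "x \<in> S" for N x
    using trig_tower_has_derivative[OF \<gamma> nz S(1,3) x conv] S(1) x
    by (rule has_field_derivative_transform_within_open) (simp_all add: g_def trig_term)
  have g0: "(g 0 has_field_derivative f x) (at x)" if x: "x \<in> S" for x
  proof -
    have "hypergeo a b (\<mu> * x powr \<gamma>) = integrated_series d \<alpha> \<beta> \<gamma> 0 (x powr \<gamma>)"
      by (simp add: hypergeo_def integrated_series_def d_def hypergeo_term_scale)
    then show ?thesis using g_deriv[OF x, of 0] by (simp add: f_def exponent_def)
  qed
  have g_Suc: "(g (Suc N) has_field_derivative h x * g N x) (at x)" if x: "x \<in> S" for N x
  proof -
    have next_exponent: "exponent \<alpha> \<beta> \<gamma> (Suc N) 0 - 1 = (\<beta> - 1) + exponent \<alpha> \<beta> \<gamma> N 0"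
      by (simp add: exponent_def algebra_simps)
    have "(\<beta> * \<eta>) ^ Suc N * (x powr (exponent \<alpha> \<beta> \<gamma> (Suc N) 0 - 1) * integrated_series d \<alpha> \<beta> \<gamma> (Suc N) (x powr \<gamma>)) =
        h x * ((\<beta> * \<eta>) ^ N * (x powr exponent \<alpha> \<beta> \<gamma> N 0 * integrated_series d \<alpha> \<beta> \<gamma> (Suc N) (x powr \<gamma>)))"
      by (simp only: next_exponent powr_add h_def power_Suc mult_ac)
    also have "\<dots> = h x * g N x"
      unfolding g_def trig_term[OF x] trig_tower_eq_monomial[where \<gamma> = \<gamma>] ..
    finally show ?thesis using g_deriv[OF x, of "Suc N"] by simp
  qed
  have u: "(u has_field_derivative h x) (at x)" if "x \<in> S" for x
  proof -
    have "x \<notin> \<real>\<^sub>\<le>\<^sub>0" using that S(3) by blast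
    from DERIV_cmult[OF has_field_derivative_powr[OF this], of \<eta> \<beta>] show ?thesis
      by (simp add: u_def[abs_def] h_def mult_ac)
  qed
  have h: "continuous_on S h"
  proof (rule continuous_at_imp_continuous_on, rule ballI)
    fix x assume "x \<in> S"
    then have "x \<notin> \<real>\<^sub>\<le>\<^sub>0" using S(3) by blast
    from DERIV_isCont[OF DERIV_cmult[OF has_field_derivative_powr[OF this]]]
    show "isCont h x" unfolding h_def[abs_def] .
  qed
  define H where "H x = cos (u x) * (\<Sum>j. (-1) ^ j * g (2 * j) x) +
    sin (u x) * (\<Sum>j. (-1) ^ j * g (2 * j + 1) x)" for x
  have series: "summable (\<lambda>j. (-1) ^ j * g (2 * j + i) x)"
    "(\<Sum>j. (-1) ^ j * g (2 * j + i) x) =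
       x powr (\<alpha> + 1) * (\<Sum>j. (-1) ^ j * trig_term a b \<alpha> \<beta> \<gamma> \<eta> \<mu> x (2 * j + i))"
    if "x \<in> S" "i = 0 \<or> i = 1" for x i
  proof -
    have *: "summable (\<lambda>j. (-1) ^ j * trig_term a b \<alpha> \<beta> \<gamma> \<eta> \<mu> x (2 * j + i))"
      using outer[OF that(1)] that(2) by auto
    from summable_mult[OF *, of "x powr (\<alpha> + 1)"] suminf_mult[OF *, of "x powr (\<alpha> + 1)"]
    show "summable (\<lambda>j. (-1) ^ j * g (2 * j + i) x)"
      "(\<Sum>j. (-1) ^ j * g (2 * j + i) x) =
         x powr (\<alpha> + 1) * (\<Sum>j. (-1) ^ j * trig_term a b \<alpha> \<beta> \<gamma> \<eta> \<mu> x (2 * j + i))"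
      by (simp_all add: g_def mult_ac)
  qed
  have H: "(H has_field_derivative cos (u x) * f x) (at x)" if x: "x \<in> S" for x
    unfolding H_def[abs_def]
    using series(1)[of _ 0] series(1)[of _ 1]
    by (intro repeated_integration_by_parts[OF S(1) x g0 g_Suc u h]) auto
  have H_eq: "H x = x powr (\<alpha> + 1) * cos (\<eta> * x powr \<beta>) *
        (\<Sum>j. (-1) ^ j * trig_term a b \<alpha> \<beta> \<gamma> \<eta> \<mu> x (2 * j)) +
      x powr (\<alpha> + 1) * sin (\<eta> * x powr \<beta>) *
        (\<Sum>j. (-1) ^ j * trig_term a b \<alpha> \<beta> \<gamma> \<eta> \<mu> x (2 * j + 1))" if x: "x \<in> S" for x
    using series(2)[OF x, of 0] series(2)[OF x, of 1]
    by (simp add: H_def u_def mult_ac)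
  have antiderivatives: "(\<forall>x\<in>S. (G has_field_derivative cos (u x) * f x) (at x)) \<longleftrightarrow>
      (\<exists>C. \<forall>x\<in>S. G x = H x + C)" for G
  proof
    assume G: "\<forall>x\<in>S. (G has_field_derivative cos (u x) * f x) (at x)"
    have "((\<lambda>x. G x - H x) has_field_derivative 0) (at x)" if "x \<in> S" for x
      using DERIV_diff[OF G[rule_format, OF that] H[OF that]] by simp
    then have "(\<lambda>x. G x - H x) constant_on S"
      using S(1,2) by (intro has_field_derivative_0_imp_constant_on)
    then obtain C where "\<And>x. x \<in> S \<Longrightarrow> G x - H x = C"
      unfolding constant_on_def by blast
    then show "\<exists>C. \<forall>x\<in>S. G x = H x + C"
      by (intro exI[of _ C]) (auto simp: algebra_simps)
  next
    assume "\<exists>C. \<forall>x\<in>S. G x = H x + C"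
    then obtain C where C: "\<And>x. x \<in> S \<Longrightarrow> G x = H x + C" by blast
    show "\<forall>x\<in>S. (G has_field_derivative cos (u x) * f x) (at x)"
    proof
      fix x assume x: "x \<in> S"
      have "((\<lambda>x. H x + C) has_field_derivative cos (u x) * f x) (at x)"
        using DERIV_add[OF H[OF x] DERIV_const[of C]] by simp
      then show "(G has_field_derivative cos (u x) * f x) (at x)"
        using S(1) x by (rule has_field_derivative_transform_within_open) (simp add: C)
    qed
  qed
  have integrand: "x powr \<alpha> * cos (\<eta> * x powr \<beta>) * hypergeo a b (\<mu> * x powr \<gamma>) = cos (u x) * f x" for x
    by (simp add: f_def u_def)
  have inner: "summable (hypergeo_term (a @ extra_params \<alpha> \<beta> \<gamma> N)
      (b @ extra_params (\<alpha> + \<gamma>) \<beta> \<gamma> N) (\<mu> * x powr \<gamma>))" if "x \<in> S" for x N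
    using F_fun_eq_integrated_series(1)[OF \<gamma> nz abs_conv[OF that, unfolded d_def]] .
  show ?thesis
    unfolding integrand antiderivatives using inner outer
    by (simp add: H_eq)
qed

end
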